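(* Let $\mathcal{K}\subset\mathbb{R}^n$ be a proper subdual cone, let $\mathcal{C}=\mathbb{S}^{n-1}\cap\operatorname{int}(\mathcal{K})$, and let $A=A^{\top}\in\mathbb{R}^{n\times n}$. Write $q_A(x)=\langle Ax,x\rangle$ and, for $x\ne0$, $\varphi_A(x)=\langle Ax,x\rangle/\|x\|^2$. The following statements are equivalent: (a) The quadratic function $q_A:\mathcal{C}\to\mathbb{R}$ is spherically quasi-convex; (b) $\langle Ax,y\rangle\le\langle x,y\rangle\max\{q_A(x),q_A(y)\}$ for all $x,y\in\mathbb{S}^{n-1}\cap\mathcal{K}$; (c) $\dfrac{\langle Ax,y\rangle}{\langle x,y\rangle}\le\max\{\varphi_A(x),\varphi_A(y)\}$ for all $x,y\in\mathcal{K}$ with $\langle x,y\rangle\ne0$.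
   Context: $\langle\cdot,\cdot\rangle$ and $\|\cdot\|$ are the canonical inner product and norm on $\mathbb{R}^n$; $\mathbb{S}^{n-1}=\{x\in\mathbb{R}^n:\|x\|=1\}$ with intrinsic distance $d(x,y)=\arccos\langle x,y\rangle$. A cone is a set invariant under multiplication by positive scalars. A proper cone is a closed convex cone with nonempty interior which is pointed ($\mathcal{K}\cap(-\mathcal{K})\subseteq\{0\}$). The dual cone is $\mathcal{K}^*=\{x\in\mathbb{R}^n:\langle x,y\rangle\ge 0\ \forall y\in\mathcal{K}\}$, and $\mathcal{K}$ is subdual if $\mathcal{K}\subset\mathcal{K}^*$. A minimal geodesic segment is a constant-speed parametrized arc of a great circle whose length equals the distance $d$ between its endpoints. A set $\mathcal{C}\subseteq\mathbb{S}^{n-1}$ is spherically convex if for any $x,y\in\mathcal{C}$ all minimal geodesic segments joining $x$ to $y$ are contained in $\mathcal{C}$; the set $\mathcal{C}=\mathbb{S}^{n-1}\cap\operatorname{int}(\mathcal{K})$ is spherically convex. A function $f:\mathcal{C}\to\mathbb{R}$ on a spherically convex set is spherically quasi-convex if for every minimal geodesic segment $\gamma:I\to\mathcal{C}$ ($I\subset\mathbb{R}$ an interval), $f(\gamma(t))\le\max\{f(\gamma(t_1)),f(\gamma(t_2))\}$ for all $t\in[t_1,t_2]\subset I$. *)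

theory Defs
  imports "HOL-Analysis.Analysis"
begin

(* The library predicates cone and conic require closure under all scalars c >= 0 and hence
   0 \<in> K for nonempty K; here only positive scalars are considered. *)
definition positive_cone :: "'a::real_vector set \<Rightarrow> bool" where
  "positive_cone K \<longleftrightarrow> (\<forall>x\<in>K. \<forall>c>0. c *\<^sub>R x \<in> K)"

definition proper_cone :: "'a::euclidean_space set \<Rightarrow> bool" where
  "proper_cone K \<longleftrightarrow>
     positive_cone K \<and> closed K \<and> convex K \<and> interior K \<noteq> {} \<and> K \<inter> uminus ` K \<subseteq> {0}"

definition dual_cone :: "'a::euclidean_space set \<Rightarrow> 'a set" where
  "dual_cone K = {x. \<forall>y\<in>K. x \<bullet> y \<ge> 0}"

definition subdual :: "'a::euclidean_space set \<Rightarrow> bool" where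
  "subdual K \<longleftrightarrow> K \<subseteq> dual_cone K"

definition sphere_dist :: "'a::euclidean_space \<Rightarrow> 'a \<Rightarrow> real" where
  "sphere_dist x y = arccos (x \<bullet> y)"

(* For u, v orthonormal, t \<mapsto> cos (w * t) u + sin (w * t) v runs through the unit great circle in
   the plane spanned by u and v with constant speed w, so its length over [a, b] is w * (b - a).
   Constant segments (w = 0 or a = b) are allowed; the direction of travel is absorbed in v.
   Only the values of g on [a, b] matter. *)
definition minimal_geodesic_segment :: "(real \<Rightarrow> 'a::euclidean_space) \<Rightarrow> real \<Rightarrow> real \<Rightarrow> bool" where
  "minimal_geodesic_segment g a b \<longleftrightarrow> a \<le> b \<and>
     (\<exists>w u v. w \<ge> 0 \<and> norm u = 1 \<and> norm v = 1 \<and> u \<bullet> v = 0 \<and>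
        (\<forall>t\<in>{a..b}. g t = cos (w * t) *\<^sub>R u + sin (w * t) *\<^sub>R v) \<and>
        w * (b - a) = sphere_dist (g a) (g b))"

definition spherically_convex :: "'a::euclidean_space set \<Rightarrow> bool" where
  "spherically_convex C \<longleftrightarrow> C \<subseteq> sphere 0 1 \<and>
     (\<forall>x\<in>C. \<forall>y\<in>C. \<forall>g a b. minimal_geodesic_segment g a b \<and> g a = x \<and> g b = y
        \<longrightarrow> g ` {a..b} \<subseteq> C)"

(* As with convex_on, convexity of the domain is part of the notion. *)
definition spherically_quasi_convex_on ::
    "'a::euclidean_space set \<Rightarrow> ('a \<Rightarrow> real) \<Rightarrow> bool" where
  "spherically_quasi_convex_on C f \<longleftrightarrow> spherically_convex C \<and>
     (\<forall>g a b. minimal_geodesic_segment g a b \<and> g ` {a..b} \<subseteq> C \<longrightarrow>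
        (\<forall>t1 t2 t. {t1..t2} \<subseteq> {a..b} \<and> t \<in> {t1..t2} \<longrightarrow>
           f (g t) \<le> max (f (g t1)) (f (g t2))))"

definition quad_fun :: "real^'n^'n \<Rightarrow> real^'n \<Rightarrow> real" where
  "quad_fun A x = (A *v x) \<bullet> x"

(* The Rayleigh quotient; used for x \<noteq> 0 only. *)
definition rayleigh_quotient :: "real^'n^'n \<Rightarrow> real^'n \<Rightarrow> real" where
  "rayleigh_quotient A x = ((A *v x) \<bullet> x) / (norm x)\<^sup>2"

end

theory Submission
  imports Defs
begin

text \<open>
  All three conditions are compared with the homogeneous inequality
  \<open>\<langle>Ax, y\<rangle> \<le> \<langle>x, y\<rangle> max (\<phi>\<^sub>A x) (\<phi>\<^sub>A y)\<close> for nonzero \<open>x\<close>, \<open>y\<close>, which holds on \<open>K\<close> as soon as it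
  holds on the interior, by continuity of the Rayleigh quotient. It gives quasi-convexity because
  every point of a minimal geodesic is a unit vector \<open>\<alpha>x + \<beta>y\<close> with \<open>\<alpha>, \<beta> \<ge> 0\<close>, so
  that \<open>q\<^sub>A (\<alpha>x + \<beta>y) \<le> m \<parallel>\<alpha>x + \<beta>y\<parallel>\<^sup>2 = m\<close> with \<open>m = max (q\<^sub>A x) (q\<^sub>A y)\<close>. Conversely, if
  \<open>q\<^sub>A y \<le> q\<^sub>A x\<close>, quasi-convexity makes the derivative of \<open>q\<^sub>A\<close> at \<open>x\<close> along the geodesic to \<open>y\<close>
  nonpositive, which is the inequality for \<open>x\<close> and \<open>y\<close>.
\<close>

section \<open>Cones and their interiors\<close>

lemma positive_cone_interior:
  fixes K :: "'a::euclidean_space set"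
  assumes "positive_cone K"
  shows "positive_cone (interior K)"
  unfolding positive_cone_def
proof (intro ballI allI impI)
  fix x and c :: real
  assume x: "x \<in> interior K" and c: "c > 0"
  have "open ((*\<^sub>R) c ` interior K)"
    using c by (intro open_scaling) auto
  moreover have "(*\<^sub>R) c ` interior K \<subseteq> K"
    using assms c interior_subset unfolding positive_cone_def by blast
  ultimately have "(*\<^sub>R) c ` interior K \<subseteq> interior K"
    by (rule interior_maximal[rotated])
  then show "c *\<^sub>R x \<in> interior K"
    using x by blast
qed

text \<open>Normalising the coefficients gives a convex combination, which is then scaled back. The
  condition \<open>\<alpha> + \<beta> > 0\<close> is there because a positive cone may omit the
  origin.\<close>

lemma positive_cone_combination:
  assumes "positive_cone S" "convex S" "x \<in> S" "y \<in> S" "\<alpha> \<ge> 0" "\<beta> \<ge> 0" "\<alpha> + \<beta> > 0"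
  shows "\<alpha> *\<^sub>R x + \<beta> *\<^sub>R y \<in> S"
proof -
  have "(\<alpha> / (\<alpha> + \<beta>)) *\<^sub>R x + (\<beta> / (\<alpha> + \<beta>)) *\<^sub>R y \<in> S"
    using assms by (intro convexD) (auto simp flip: add_divide_distrib)
  then have "(\<alpha> + \<beta>) *\<^sub>R ((\<alpha> / (\<alpha> + \<beta>)) *\<^sub>R x + (\<beta> / (\<alpha> + \<beta>)) *\<^sub>R y) \<in> S"
    using assms unfolding positive_cone_def by blast
  then show ?thesis
    using assms(7) by (simp add: scaleR_add_right)
qed

text \<open>From an interior point one can move a distance \<open>e\<close> in the direction of
  \<open>-y\<close> and stay in \<open>K\<close>. Subduality keeps the inner product with
  \<open>y\<close> nonnegative there, so \<open>x \<bullet> y\<close> is at least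
  \<open>e * norm y\<close>.\<close>

lemma subdual_inner_interior_pos:
  fixes K :: "'a::euclidean_space set"
  assumes "subdual K" "x \<in> interior K" "y \<in> K" "y \<noteq> 0"
  shows "x \<bullet> y > 0"
proof -
  obtain e where e: "e > 0" "cball x e \<subseteq> K"
    using assms(2) mem_interior_cball by blast
  have "dist x (x - (e / norm y) *\<^sub>R y) = e"
    using e(1) assms(4) by (simp add: dist_norm)
  then have "x - (e / norm y) *\<^sub>R y \<in> K"
    using e(2) by (auto simp: subset_iff)
  then have "0 \<le> (x - (e / norm y) *\<^sub>R y) \<bullet> y"
    using assms(1,3) unfolding subdual_def dual_cone_def by blast
  then have "(e / norm y) * (y \<bullet> y) \<le> x \<bullet> y"
    by (simp add: inner_diff_left)
  moreover have "(e / norm y) * (y \<bullet> y) > 0"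
    using e(1) assms(4) by simp
  ultimately show ?thesis by linarith
qed

section \<open>The homogeneous inequality\<close>

definition rayleigh_product_bound :: "real^'n^'n \<Rightarrow> (real^'n) set \<Rightarrow> bool" where
  "rayleigh_product_bound A S \<longleftrightarrow> (\<forall>x\<in>S - {0}. \<forall>y\<in>S - {0}.
     (A *v x) \<bullet> y \<le> (x \<bullet> y) * max (rayleigh_quotient A x) (rayleigh_quotient A y))"

lemma rayleigh_quotient_scaleR:
  "c \<noteq> 0 \<Longrightarrow> rayleigh_quotient A (c *\<^sub>R x) = rayleigh_quotient A x"
  by (simp add: rayleigh_quotient_def matrix_vector_mult_scaleR power_mult_distrib)
    (simp add: power2_eq_square)

lemma rayleigh_quotient_unit: "norm x = 1 \<Longrightarrow> rayleigh_quotient A x = quad_fun A x"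
  by (simp add: rayleigh_quotient_def quad_fun_def)

text \<open>Both sides are positively homogeneous of degree one in each variable, so unit vectors
  suffice. For \<open>S = K\<close> the right-hand side is statement (b).\<close>

lemma rayleigh_product_bound_iff_sphere:
  assumes "positive_cone S"
  shows "rayleigh_product_bound A S \<longleftrightarrow> (\<forall>x\<in>sphere 0 1 \<inter> S. \<forall>y\<in>sphere 0 1 \<inter> S.
           (A *v x) \<bullet> y \<le> (x \<bullet> y) * max (quad_fun A x) (quad_fun A y))"
    (is "?L \<longleftrightarrow> ?R")
proof
  assume L: ?L
  show ?R
  proof (intro ballI)
    fix x y assume "x \<in> sphere 0 1 \<inter> S" "y \<in> sphere 0 1 \<inter> S"
    then have "norm x = 1" "norm y = 1" "x \<in> S - {0}" "y \<in> S - {0}"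
      by auto
    then show "(A *v x) \<bullet> y \<le> (x \<bullet> y) * max (quad_fun A x) (quad_fun A y)"
      using L unfolding rayleigh_product_bound_def by (metis rayleigh_quotient_unit)
  qed
next
  assume R: ?R
  show ?L
    unfolding rayleigh_product_bound_def
  proof (intro ballI)
    fix x y assume xy: "x \<in> S - {0}" "y \<in> S - {0}"
    define u v where "u = (1 / norm x) *\<^sub>R x" and "v = (1 / norm y) *\<^sub>R y"
    have uv: "norm u = 1" "norm v = 1" "u \<in> S" "v \<in> S"
      using xy assms by (auto simp: u_def v_def positive_cone_def)
    have x: "x = norm x *\<^sub>R u" and y: "y = norm y *\<^sub>R v"
      using xy by (auto simp: u_def v_def)
    have "(A *v u) \<bullet> v \<le> (u \<bullet> v) * max (quad_fun A u) (quad_fun A v)"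
      using R uv by auto
    also have "quad_fun A u = rayleigh_quotient A x"
      using xy rayleigh_quotient_scaleR[of "norm x" A u] rayleigh_quotient_unit[OF uv(1)] x by auto
    also have "quad_fun A v = rayleigh_quotient A y"
      using xy rayleigh_quotient_scaleR[of "norm y" A v] rayleigh_quotient_unit[OF uv(2)] y by auto
    finally have "(norm x * norm y) * ((A *v u) \<bullet> v) \<le> (norm x * norm y) *
        ((u \<bullet> v) * max (rayleigh_quotient A x) (rayleigh_quotient A y))"
      by (intro mult_left_mono) auto
    moreover have "(A *v x) \<bullet> y = (norm x * norm y) * ((A *v u) \<bullet> v)"
      by (subst x, subst y) (simp only: matrix_vector_mult_scaleR inner_scaleR_left inner_scaleR_right ac_simps)
    moreover have "x \<bullet> y = (norm x * norm y) * (u \<bullet> v)"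
      by (subst x, subst y) (simp only: inner_scaleR_left inner_scaleR_right ac_simps)
    ultimately show "(A *v x) \<bullet> y \<le> (x \<bullet> y) * max (rayleigh_quotient A x) (rayleigh_quotient A y)"
      by (simp only: mult.assoc)
  qed
qed

lemma tendsto_rayleigh_quotient:
  assumes "(f \<longlongrightarrow> x) F" "x \<noteq> 0"
  shows "((\<lambda>i. rayleigh_quotient A (f i)) \<longlongrightarrow> rayleigh_quotient A x) F"
  unfolding rayleigh_quotient_def
  using assms by (intro tendsto_intros bounded_linear.tendsto[OF matrix_vector_mul_bounded_linear]) auto

text \<open>Away from the origin both sides are continuous, so the non-strict inequality survives
  limits. This carries it from the interior of a cone to its boundary.\<close>

lemma rayleigh_product_bound_closure:
  assumes "rayleigh_product_bound A S"
  shows "rayleigh_product_bound A (closure S)"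
  unfolding rayleigh_product_bound_def
proof (intro ballI)
  fix x y assume xy: "x \<in> closure S - {0}" "y \<in> closure S - {0}"
  obtain f where f: "\<And>n. f n \<in> S" "f \<longlonglongrightarrow> x"
    using xy closure_sequential by blast
  obtain g where g: "\<And>n. g n \<in> S" "g \<longlonglongrightarrow> y"
    using xy closure_sequential by blast
  \<comment> \<open>\<open>S\<close> may contain the origin, but a sequence with nonzero limit
    eventually avoids it.\<close>
  have "\<forall>\<^sub>F n in sequentially. f n \<noteq> 0" "\<forall>\<^sub>F n in sequentially. g n \<noteq> 0"
    using f(2) g(2) xy tendsto_imp_eventually_ne by blast+
  then have "\<forall>\<^sub>F n in sequentially. (A *v f n) \<bullet> g n \<le> (f n \<bullet> g n) *
      max (rayleigh_quotient A (f n)) (rayleigh_quotient A (g n))"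
    by eventually_elim (use assms f(1) g(1) in \<open>auto simp: rayleigh_product_bound_def\<close>)
  moreover have "(\<lambda>n. (A *v f n) \<bullet> g n) \<longlonglongrightarrow> (A *v x) \<bullet> y"
    by (intro tendsto_intros bounded_linear.tendsto[OF matrix_vector_mul_bounded_linear] f g)
  moreover have "(\<lambda>n. (f n \<bullet> g n) * max (rayleigh_quotient A (f n)) (rayleigh_quotient A (g n)))
      \<longlonglongrightarrow> (x \<bullet> y) * max (rayleigh_quotient A x) (rayleigh_quotient A y)"
    using xy by (intro tendsto_intros tendsto_rayleigh_quotient f g tendsto_max) auto
  ultimately show "(A *v x) \<bullet> y \<le> (x \<bullet> y) * max (rayleigh_quotient A x) (rayleigh_quotient A y)"
    by (intro tendsto_le[OF sequentially_bot])
qed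

section \<open>Quadratic forms of symmetric matrices\<close>

lemma symmetric_matrix_inner_commute:
  assumes "A = transpose A"
  shows "(A *v x) \<bullet> y = (A *v y) \<bullet> (x :: real^'n)"
  by (metis assms dot_lmul_matrix inner_commute transpose_matrix_vector)

lemma quad_fun_combination:
  assumes "A = transpose A"
  shows "quad_fun A (\<alpha> *\<^sub>R x + \<beta> *\<^sub>R y) =
    \<alpha>\<^sup>2 * quad_fun A x + 2 * \<alpha> * \<beta> * ((A *v x) \<bullet> y) + \<beta>\<^sup>2 * quad_fun A y"
  using symmetric_matrix_inner_commute[OF assms, of y x]
  by (simp add: quad_fun_def matrix_vector_right_distrib matrix_vector_mult_scaleR
      inner_add_left inner_add_right power2_eq_square algebra_simps)

section \<open>Great circles and minimal geodesics\<close>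

lemma great_circle_arc_combination:
  fixes u v :: "'a::real_vector" and w :: real
  defines "g \<equiv> \<lambda>t. cos (w * t) *\<^sub>R u + sin (w * t) *\<^sub>R v"
  assumes "w \<ge> 0" "w * (b - a) < pi" "a \<le> t" "t \<le> b"
  obtains \<alpha> \<beta> where "\<alpha> \<ge> 0" "\<beta> \<ge> 0" "\<alpha> + \<beta> > 0" "g t = \<alpha> *\<^sub>R g a + \<beta> *\<^sub>R g b"
proof (cases "w * (b - a) = 0")
  \<comment> \<open>An arc of length zero is treated apart, since the divisor
    \<open>sin (w * (b - a))\<close> used below would vanish.\<close>
  case True
  then have "w = 0 \<or> t = a"
    using assms by auto
  then have "g t = 1 *\<^sub>R g a + 0 *\<^sub>R g b"
    by (auto simp: g_def)
  then show ?thesis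
    using that[of 1 0] by simp
next
  case False
  then have w: "w > 0"
    using assms by auto
  have "w * (b - a) > 0"
    using w assms False by (auto simp: less_le)
  \<comment> \<open>Spherical linear interpolation:
    \<open>s *\<^sub>R g t = p *\<^sub>R g a + q *\<^sub>R g b\<close> by the addition theorems. A
    length strictly between 0 and \<open>pi\<close> makes \<open>s\<close> positive, and
    \<open>p\<close> and \<open>q\<close> are then sines of angles in
    \<open>{0..pi}\<close>.\<close>
  define s p q where "s = sin (w * (b - a))" and "p = sin (w * (b - t))" and "q = sin (w * (t - a))"
  have s: "s > 0"
    unfolding s_def using \<open>w * (b - a) > 0\<close> assms by (intro sin_gt_zero) auto
  have le: "w * (b - t) \<le> w * (b - a)" "w * (t - a) \<le> w * (b - a)"
    using assms w by (auto intro!: mult_left_mono)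
  then have le_pi: "w * (b - t) \<le> pi" "w * (t - a) \<le> pi"
    using assms(3) by linarith+
  have p: "p \<ge> 0" and q: "q \<ge> 0"
    unfolding p_def q_def using le_pi assms(4,5) w by (simp_all add: sin_ge_zero)
  have cos_t: "s * cos (w * t) = p * cos (w * a) + q * cos (w * b)"
    unfolding s_def p_def q_def right_diff_distrib sin_diff by (simp add: algebra_simps)
  have sin_t: "s * sin (w * t) = p * sin (w * a) + q * sin (w * b)"
    unfolding s_def p_def q_def right_diff_distrib sin_diff by (simp add: algebra_simps)
  have g_t: "g t = (p / s) *\<^sub>R g a + (q / s) *\<^sub>R g b"
  proof -
    have "cos (w * t) = p / s * cos (w * a) + q / s * cos (w * b)"
      "sin (w * t) = p / s * sin (w * a) + q / s * sin (w * b)"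
      using cos_t sin_t s by (auto simp: field_simps)
    then show ?thesis
      unfolding g_def by (simp add: scaleR_add_left scaleR_add_right)
  qed
  \<comment> \<open>If both coefficients vanished, cosine and sine would have a common zero at
    \<open>w * t\<close>.\<close>
  have "p + q \<noteq> 0"
  proof
    assume "p + q = 0"
    then have "p = 0" "q = 0"
      using p q by auto
    then have "cos (w * t) = 0" "sin (w * t) = 0"
      using cos_t sin_t s by auto
    then show False
      using sin_cos_squared_add[of "w * t"] by simp
  qed
  then have "p / s + q / s > 0"
    using p q s by (simp flip: add_divide_distrib)
  then show ?thesis
    using that[of "p / s" "q / s"] p q s g_t by simp
qed

lemma norm_great_circle:
  fixes u v :: "'a::real_inner"
  assumes "norm u = 1" "norm v = 1" "u \<bullet> v = 0"
  shows "norm (cos s *\<^sub>R u + sin s *\<^sub>R v) = 1"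
proof -
  have "u \<bullet> u = 1" "v \<bullet> v = 1" "v \<bullet> u = 0"
    using assms by (simp_all add: norm_eq_1 inner_commute)
  then show ?thesis
    using assms(3) by (simp add: norm_eq_1 inner_add_left inner_add_right flip: power2_eq_square)
qed

text \<open>The bound \<open>g a \<bullet> g b > -1\<close> excludes antipodal endpoints, so the arc
  is shorter than \<open>pi\<close>, and so is each subarc. The subinterval \<open>{t1..t2}\<close>
  matches the form of quasi-convexity.\<close>

lemma minimal_geodesic_segment_combination:
  assumes "minimal_geodesic_segment g a b" "g a \<bullet> g b > -1" "{t1..t2} \<subseteq> {a..b}" "t \<in> {t1..t2}"
  obtains \<alpha> \<beta> where "\<alpha> \<ge> 0" "\<beta> \<ge> 0" "\<alpha> + \<beta> > 0" "g t = \<alpha> *\<^sub>R g t1 + \<beta> *\<^sub>R g t2"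
proof -
  obtain w u v where w: "w \<ge> 0" "norm u = 1" "norm v = 1" "u \<bullet> v = 0"
    and g: "\<And>t. t \<in> {a..b} \<Longrightarrow> g t = cos (w * t) *\<^sub>R u + sin (w * t) *\<^sub>R v"
    and d: "w * (b - a) = sphere_dist (g a) (g b)" and ab: "a \<le> b"
    using assms(1) unfolding minimal_geodesic_segment_def by auto
  have "norm (g a) = 1" "norm (g b) = 1"
    using g ab norm_great_circle[OF w(2-4)] by auto
  then have "g a \<bullet> g b \<le> 1"
    using norm_cauchy_schwarz[of "g a" "g b"] by simp
  then have "w * (b - a) < pi"
    using arccos_less_arccos[of "-1" "g a \<bullet> g b"] assms(2) d by (simp add: sphere_dist_def)
  moreover have t: "t1 \<in> {a..b}" "t2 \<in> {a..b}" "t \<in> {a..b}"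
    using assms(3,4) by auto
  then have "w * (t2 - t1) \<le> w * (b - a)"
    using w(1) by (intro mult_left_mono) auto
  ultimately have "w * (t2 - t1) < pi"
    by linarith
  with great_circle_arc_combination[of w t2 t1 t u v] w(1) assms(4) that g t show ?thesis
    by (metis atLeastAtMost_iff)
qed

text \<open>Gram-Schmidt: \<open>v\<close> is the normalised component of \<open>y\<close>
  orthogonal to \<open>x\<close>, hence the initial velocity of the geodesic from \<open>x\<close>
  to \<open>y\<close>. The numbers \<open>c\<close> and \<open>s\<close> in the proof are the cosine
  and sine of the distance.\<close>

lemma minimal_geodesic_segment_initial_direction:
  fixes x y :: "'a::euclidean_space"
  assumes "norm x = 1" "norm y = 1" "x \<noteq> y" "x \<noteq> - y"
  obtains v where "norm v = 1" "x \<bullet> v = 0" "x \<bullet> y < 1" "y = (x \<bullet> y) *\<^sub>R x + sqrt (1 - (x \<bullet> y)\<^sup>2) *\<^sub>R v"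
    "minimal_geodesic_segment (\<lambda>t. cos t *\<^sub>R x + sin t *\<^sub>R v) 0 (sphere_dist x y)"
proof -
  define c where "c = x \<bullet> y"
  define s where "s = sqrt (1 - c\<^sup>2)"
  define v where "v = (1 / s) *\<^sub>R (y - c *\<^sub>R x)"
  have xx: "x \<bullet> x = 1" and yy: "y \<bullet> y = 1"
    using assms by (simp_all add: norm_eq_1)
  \<comment> \<open>These squared norms are \<open>2 - 2 * c\<close> and \<open>2 + 2 * c\<close>,
    so \<open>c\<close> lies strictly between -1 and 1 and the division by \<open>s\<close> is
    legitimate.\<close>
  have "(x - y) \<bullet> (x - y) > 0" "(x + y) \<bullet> (x + y) > 0"
    using assms by (simp_all add: eq_neg_iff_add_eq_0)
  then have c: "c < 1" "c > -1"
    using xx yy by (simp_all add: c_def inner_add_left inner_add_right inner_diff_left inner_diff_right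
        inner_commute)
  then have c2: "c\<^sup>2 < 1"
    by (simp add: abs_square_less_1)
  then have s: "s > 0" "s\<^sup>2 = 1 - c\<^sup>2"
    by (simp_all add: s_def)
  have v: "norm v = 1"
  proof -
    have "(y - c *\<^sub>R x) \<bullet> (y - c *\<^sub>R x) = s * s"
      using xx yy s(2) by (simp add: inner_diff_left inner_diff_right inner_commute power2_eq_square
          flip: c_def)
    then show ?thesis
      using s(1) by (simp add: v_def norm_eq_sqrt_inner)
  qed
  have xv: "x \<bullet> v = 0"
    by (simp add: v_def inner_diff_right xx c_def)
  have y: "y = c *\<^sub>R x + s *\<^sub>R v"
    using s(1) by (simp add: v_def)
  have "cos (sphere_dist x y) = c" "sin (sphere_dist x y) = s"
    using c by (simp_all add: sphere_dist_def sin_arccos s_def flip: c_def)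
  then have "cos (sphere_dist x y) *\<^sub>R x + sin (sphere_dist x y) *\<^sub>R v = y"
    using y by simp
  moreover have "sphere_dist x y \<ge> 0"
    using c by (simp add: sphere_dist_def arccos_lbound flip: c_def)
  ultimately have "minimal_geodesic_segment (\<lambda>t. cos t *\<^sub>R x + sin t *\<^sub>R v) 0 (sphere_dist x y)"
    unfolding minimal_geodesic_segment_def using assms(1) v xv
    by (intro conjI exI[of _ 1] exI[of _ x] exI[of _ v]) auto
  then show ?thesis
    using that[OF v xv] c(1) y unfolding c_def s_def by blast
qed

section \<open>From quasi-convexity to the homogeneous inequality\<close>

lemma quad_fun_initial_slope:
  assumes A: "A = transpose A" and "\<theta> > 0"
    and le: "\<And>t. 0 < t \<Longrightarrow> t < \<theta> \<Longrightarrow> quad_fun A (cos t *\<^sub>R x + sin t *\<^sub>R v) \<le> quad_fun A x"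
  shows "(A *v x) \<bullet> v \<le> 0"
proof -
  \<comment> \<open>The cap at \<open>pi\<close> keeps \<open>sin t\<close> positive, so that it can
    be cancelled.\<close>
  have "\<forall>\<^sub>F t in at_right 0. t \<in> {0<..<min \<theta> pi}"
    using assms(2) by (intro eventually_at_right_real) simp
  then have "\<forall>\<^sub>F t in at_right 0.
      2 * cos t * ((A *v x) \<bullet> v) \<le> sin t * (quad_fun A x - quad_fun A v)"
  proof eventually_elim
    case (elim t)
    then have "sin t > 0"
      by (simp add: sin_gt_zero)
    have "quad_fun A (cos t *\<^sub>R x + sin t *\<^sub>R v) \<le> quad_fun A x"
      using le elim by simp
    \<comment> \<open>With the squared cosine written as \<open>1 - (sin t)\<^sup>2\<close>, the
      term \<open>quad_fun A x\<close> cancels and every remaining term has a factor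
      \<open>sin t\<close>. Dividing by it and letting \<open>t\<close> tend to 0 from the right
      gives the sign of the one-sided derivative \<open>2 * ((A *v x) \<bullet> v)\<close>.\<close>
    then have "(1 - (sin t)\<^sup>2) * quad_fun A x + 2 * cos t * sin t * ((A *v x) \<bullet> v)
        + (sin t)\<^sup>2 * quad_fun A v \<le> quad_fun A x"
      by (simp add: quad_fun_combination[OF A] cos_squared_eq)
    then have "sin t * (2 * cos t * ((A *v x) \<bullet> v)) \<le> sin t * (sin t * (quad_fun A x - quad_fun A v))"
      by (simp add: algebra_simps power2_eq_square)
    then show ?case
      using \<open>sin t > 0\<close> mult_le_cancel_left_pos by blast
  qed
  moreover have "((\<lambda>t. 2 * cos t * ((A *v x) \<bullet> v)) \<longlongrightarrow> 2 * cos 0 * ((A *v x) \<bullet> v)) (at_right 0)"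
    by (intro tendsto_intros)
  moreover have "((\<lambda>t. sin t * (quad_fun A x - quad_fun A v)) \<longlongrightarrow>
      sin 0 * (quad_fun A x - quad_fun A v)) (at_right 0)"
    by (intro tendsto_intros)
  ultimately have "2 * cos 0 * ((A *v x) \<bullet> v) \<le> sin 0 * (quad_fun A x - quad_fun A v)"
    by (intro tendsto_le[OF trivial_limit_at_right_real])
  then show ?thesis by simp
qed

text \<open>Since \<open>x\<close> is the endpoint with the larger value, quasi-convexity bounds
  \<open>quad_fun A\<close> along the geodesic by its value at the start, so the initial slope is
  nonpositive. Splitting \<open>y\<close> into its components along \<open>x\<close> and along the
  initial direction then gives the inequality.\<close>

lemma spherically_quasi_convex_imp_le:
  assumes A: "A = transpose A" and qc: "spherically_quasi_convex_on C (quad_fun A)"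
    and xy: "x \<in> C" "y \<in> C" "x \<noteq> - y" and le: "quad_fun A y \<le> quad_fun A x"
  shows "(A *v x) \<bullet> y \<le> (x \<bullet> y) * quad_fun A x"
proof (cases "x = y")
  case True
  have "norm y = 1"
    using qc xy unfolding spherically_quasi_convex_on_def spherically_convex_def by auto
  then show ?thesis
    using True by (simp add: quad_fun_def norm_eq_1)
next
  case False
  have "norm x = 1" "norm y = 1"
    using qc xy unfolding spherically_quasi_convex_on_def spherically_convex_def by auto
  then obtain v where v: "norm v = 1" "x \<bullet> v = 0" "x \<bullet> y < 1"
      "y = (x \<bullet> y) *\<^sub>R x + sqrt (1 - (x \<bullet> y)\<^sup>2) *\<^sub>R v"
    and geo: "minimal_geodesic_segment (\<lambda>t. cos t *\<^sub>R x + sin t *\<^sub>R v) 0 (sphere_dist x y)"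
    by (rule minimal_geodesic_segment_initial_direction[OF _ _ False xy(3)]) blast
  define g where "g = (\<lambda>t. cos t *\<^sub>R x + sin t *\<^sub>R v)"
  define \<theta> where "\<theta> = sphere_dist x y"
  have bd: "\<bar>x \<bullet> y\<bar> \<le> 1"
    using Cauchy_Schwarz_ineq2[of x y] \<open>norm x = 1\<close> \<open>norm y = 1\<close> by simp
  have "\<theta> > 0"
    using arccos_less_arccos[of "x \<bullet> y" 1] v(3) bd by (simp add: \<theta>_def sphere_dist_def)
  have ends: "g 0 = x" "g \<theta> = y"
    using v(4) bd by (simp_all add: g_def \<theta>_def sphere_dist_def sin_arccos_abs cos_arccos_abs)
  have geo: "minimal_geodesic_segment g 0 \<theta>"
    using geo by (simp add: g_def \<theta>_def)
  then have "g ` {0..\<theta>} \<subseteq> C"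
    using qc xy ends unfolding spherically_quasi_convex_on_def spherically_convex_def by blast
  then have "\<And>t. t \<in> {0..\<theta>} \<Longrightarrow> quad_fun A (g t) \<le> max (quad_fun A (g 0)) (quad_fun A (g \<theta>))"
    using qc geo unfolding spherically_quasi_convex_on_def by blast
  then have "quad_fun A (cos t *\<^sub>R x + sin t *\<^sub>R v) \<le> quad_fun A x" if "0 < t" "t < \<theta>" for t
    using that le ends unfolding g_def by fastforce
  then have "(A *v x) \<bullet> v \<le> 0"
    using quad_fun_initial_slope[OF A \<open>\<theta> > 0\<close>] by blast
  then have "sqrt (1 - (x \<bullet> y)\<^sup>2) * ((A *v x) \<bullet> v) \<le> 0"
    using bd by (intro mult_nonneg_nonpos) (auto simp: abs_square_le_1)
  moreover have "(A *v x) \<bullet> y = (x \<bullet> y) * quad_fun A x + sqrt (1 - (x \<bullet> y)\<^sup>2) * ((A *v x) \<bullet> v)"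
    by (subst v(4)) (simp add: inner_add_right quad_fun_def)
  ultimately show ?thesis by simp
qed

text \<open>Pointedness rules out antipodal unit vectors in \<open>S\<close>. Symmetry of
  \<open>A\<close> allows swapping \<open>x\<close> and \<open>y\<close>, so that the first of them
  has the larger value.\<close>

lemma spherically_quasi_convex_imp_rayleigh_product_bound:
  assumes A: "A = transpose A" and cone: "positive_cone S" and S: "S \<inter> uminus ` S \<subseteq> {0}"
    and qc: "spherically_quasi_convex_on (sphere 0 1 \<inter> S) (quad_fun A)"
  shows "rayleigh_product_bound A S"
  unfolding rayleigh_product_bound_iff_sphere[OF cone]
proof (intro ballI)
  fix x y assume xy: "x \<in> sphere 0 1 \<inter> S" "y \<in> sphere 0 1 \<inter> S"
  have "x \<noteq> - y" "y \<noteq> - x"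
    using S xy by force+
  then show "(A *v x) \<bullet> y \<le> (x \<bullet> y) * max (quad_fun A x) (quad_fun A y)"
    using spherically_quasi_convex_imp_le[OF A qc xy]
      spherically_quasi_convex_imp_le[OF A qc xy(2,1)]
      symmetric_matrix_inner_commute[OF A, of x y]
    by (cases "quad_fun A y \<le> quad_fun A x") (auto simp: max_def inner_commute)
qed

section \<open>From the homogeneous inequality to quasi-convexity\<close>

lemma rayleigh_product_bound_imp_spherically_quasi_convex:
  assumes A: "A = transpose A" and cone: "positive_cone S" "convex S" and S: "S \<inter> uminus ` S \<subseteq> {0}"
    and bound: "rayleigh_product_bound A S"
  shows "spherically_quasi_convex_on (sphere 0 1 \<inter> S) (quad_fun A)"
proof -
  \<comment> \<open>Pointedness gives \<open>x + y \<noteq> 0\<close>, and the squared norm of this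
    sum of unit vectors is \<open>2 + 2 * (x \<bullet> y)\<close>.\<close>
  have inner_gt: "x \<bullet> y > -1" if "x \<in> sphere 0 1 \<inter> S" "y \<in> sphere 0 1 \<inter> S" for x y
  proof -
    have "x + y \<noteq> 0"
      using S that by (force simp: add_eq_0_iff2)
    then have "(x + y) \<bullet> (x + y) > 0"
      by simp
    moreover have "x \<bullet> x = 1" "y \<bullet> y = 1"
      using that by (simp_all add: norm_eq_1)
    ultimately show ?thesis
      by (simp add: inner_add_left inner_add_right inner_commute)
  qed
  have unit: "norm (g t) = 1" if "minimal_geodesic_segment g a b" "t \<in> {a..b}"
    for g :: "real \<Rightarrow> real^'a" and a b t
    using that norm_great_circle unfolding minimal_geodesic_segment_def by auto
  have "spherically_convex (sphere 0 1 \<inter> S)"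
    unfolding spherically_convex_def
  proof (intro conjI ballI allI impI subsetI; (elim conjE imageE)?)
    fix x y g a b z t
    assume xy: "x \<in> sphere 0 1 \<inter> S" "y \<in> sphere 0 1 \<inter> S"
      and geo: "minimal_geodesic_segment g a b" and g: "g a = x" "g b = y"
      and t: "z = g t" "t \<in> {a..b}"
    have "g a \<bullet> g b > -1"
      using inner_gt xy g by simp
    then obtain \<alpha> \<beta> where "\<alpha> \<ge> 0" "\<beta> \<ge> 0" "\<alpha> + \<beta> > 0" "g t = \<alpha> *\<^sub>R x + \<beta> *\<^sub>R y"
      using minimal_geodesic_segment_combination[OF geo _ order_refl t(2)] g by metis
    then have "g t \<in> S"
      using positive_cone_combination[OF cone] xy by auto
    then show "z \<in> sphere 0 1 \<inter> S"
      using unit[OF geo t(2)] t(1) by simp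
  qed auto
  moreover have "quad_fun A (g t) \<le> max (quad_fun A (g t1)) (quad_fun A (g t2))"
    if geo: "minimal_geodesic_segment g a b" and sub: "g ` {a..b} \<subseteq> sphere 0 1 \<inter> S"
      and t: "{t1..t2} \<subseteq> {a..b}" "t \<in> {t1..t2}" for g a b t1 t2 t
  proof -
    define x y m where "x = g t1" and "y = g t2" and "m = max (quad_fun A x) (quad_fun A y)"
    have "a \<in> {a..b}" "b \<in> {a..b}" "t \<in> {a..b}" "t1 \<in> {a..b}" "t2 \<in> {a..b}"
      using t by auto
    then have "g a \<in> sphere 0 1 \<inter> S" "g b \<in> sphere 0 1 \<inter> S" "norm (g t) = 1"
      and xy: "x \<in> sphere 0 1 \<inter> S" "y \<in> sphere 0 1 \<inter> S"
      using sub unit[OF geo] by (auto simp: x_def y_def)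
    then obtain \<alpha> \<beta> where ab: "\<alpha> \<ge> 0" "\<beta> \<ge> 0" and gt: "g t = \<alpha> *\<^sub>R x + \<beta> *\<^sub>R y"
      using minimal_geodesic_segment_combination[OF geo inner_gt t] unfolding x_def y_def by metis
    have "(A *v x) \<bullet> y \<le> (x \<bullet> y) * m"
      using bound xy unfolding rayleigh_product_bound_iff_sphere[OF cone(1)] m_def by blast
    \<comment> \<open>Nonnegative coefficients preserve the inequality in the mixed term. All three
      terms of the expansion are thus bounded with the same factor \<open>m\<close>, and the
      remaining factors add up to the squared norm of \<open>g t\<close>.\<close>
    then have "2 * \<alpha> * \<beta> * ((A *v x) \<bullet> y) \<le> 2 * \<alpha> * \<beta> * ((x \<bullet> y) * m)"
      using ab by (intro mult_left_mono) auto
    moreover have "\<alpha>\<^sup>2 * quad_fun A x \<le> \<alpha>\<^sup>2 * m" "\<beta>\<^sup>2 * quad_fun A y \<le> \<beta>\<^sup>2 * m"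
      by (auto intro!: mult_left_mono simp: m_def)
    ultimately have "quad_fun A (g t) \<le> (\<alpha>\<^sup>2 + 2 * \<alpha> * \<beta> * (x \<bullet> y) + \<beta>\<^sup>2) * m"
      by (simp add: gt quad_fun_combination[OF A] algebra_simps)
    also have "\<alpha>\<^sup>2 + 2 * \<alpha> * \<beta> * (x \<bullet> y) + \<beta>\<^sup>2 = g t \<bullet> g t"
    proof -
      have "x \<bullet> x = 1" "y \<bullet> y = 1"
        using xy by (simp_all add: norm_eq_1)
      then show ?thesis
        by (simp add: gt inner_add_left inner_add_right inner_commute power2_eq_square algebra_simps)
    qed
    also have "g t \<bullet> g t = 1"
      using \<open>norm (g t) = 1\<close> by (simp add: norm_eq_1)
    finally show ?thesis
      by (simp add: m_def x_def y_def)
  qed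
  ultimately show ?thesis
    unfolding spherically_quasi_convex_on_def by blast
qed

section \<open>The equivalences on the cone and on its interior\<close>

theorem proposition6:
  fixes K C :: "(real^'n) set" and A :: "real^'n^'n"
  assumes "proper_cone K" and "subdual K"
    and "C = sphere 0 1 \<inter> interior K"
    and "A = transpose A"
  shows
    "(spherically_quasi_convex_on C (quad_fun A)
        \<longleftrightarrow> (\<forall>x\<in>sphere 0 1 \<inter> K. \<forall>y\<in>sphere 0 1 \<inter> K.
              (A *v x) \<bullet> y \<le> (x \<bullet> y) * max (quad_fun A x) (quad_fun A y))) \<and>
     ((\<forall>x\<in>sphere 0 1 \<inter> K. \<forall>y\<in>sphere 0 1 \<inter> K.
              (A *v x) \<bullet> y \<le> (x \<bullet> y) * max (quad_fun A x) (quad_fun A y))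
        \<longleftrightarrow> (\<forall>x\<in>K. \<forall>y\<in>K. x \<bullet> y \<noteq> 0 \<longrightarrow>
              ((A *v x) \<bullet> y) / (x \<bullet> y) \<le> max (rayleigh_quotient A x) (rayleigh_quotient A y)))"
proof -
  let ?I = "interior K"
  have K: "positive_cone K" "closed K" "convex K" "?I \<noteq> {}" "K \<inter> uminus ` K \<subseteq> {0}"
    using assms(1) unfolding proper_cone_def by auto
  have I: "positive_cone ?I" "convex ?I" "?I \<inter> uminus ` ?I \<subseteq> {0}"
    using K interior_subset positive_cone_interior by (auto intro: convex_interior)
  \<comment> \<open>A closed convex set with nonempty interior is the closure of that interior.
    Hence the inequality on \<open>?I\<close>, where quasi-convexity is formulated, is equivalent to
    the one on \<open>K\<close>.\<close>
  have "closure ?I = K"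
    using K convex_closure_interior closure_closed by metis
  then have I_imp_K: "rayleigh_product_bound A ?I \<Longrightarrow> rayleigh_product_bound A K"
    using rayleigh_product_bound_closure by metis
  have K_imp_I: "rayleigh_product_bound A K \<Longrightarrow> rayleigh_product_bound A ?I"
    using interior_subset unfolding rayleigh_product_bound_def by blast
  have a: "spherically_quasi_convex_on C (quad_fun A) \<longleftrightarrow> rayleigh_product_bound A K"
    unfolding assms(3)
    using spherically_quasi_convex_imp_rayleigh_product_bound[OF assms(4) I(1,3)]
      rayleigh_product_bound_imp_spherically_quasi_convex[OF assms(4) I] I_imp_K K_imp_I by blast
  have c: "rayleigh_product_bound A K \<longleftrightarrow> (\<forall>x\<in>K. \<forall>y\<in>K. x \<bullet> y \<noteq> 0 \<longrightarrow>
      ((A *v x) \<bullet> y) / (x \<bullet> y) \<le> max (rayleigh_quotient A x) (rayleigh_quotient A y))"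
    (is "_ \<longleftrightarrow> ?c")
  proof
    assume bound: "rayleigh_product_bound A K"
    show ?c
    proof (intro ballI impI)
      fix x y assume xy: "x \<in> K" "y \<in> K" "x \<bullet> y \<noteq> 0"
      \<comment> \<open>Subduality gives nonnegativity, so a nonzero inner product is positive and
        dividing by it keeps the direction of the inequality.\<close>
      then have "x \<bullet> y > 0"
        using assms(2) unfolding subdual_def dual_cone_def by force
      moreover have "x \<in> K - {0}" "y \<in> K - {0}"
        using xy by auto
      ultimately show "((A *v x) \<bullet> y) / (x \<bullet> y) \<le> max (rayleigh_quotient A x) (rayleigh_quotient A y)"
        using bound unfolding rayleigh_product_bound_def by (simp add: pos_divide_le_eq mult.commute)
    qed
  next
    assume c: ?c
    \<comment> \<open>Orthogonal boundary vectors are not covered by (c). In the interior inner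
      products are positive, so (c) applies to every pair there, and the closure argument recovers
      the missing boundary pairs.\<close>
    have "rayleigh_product_bound A ?I"
      unfolding rayleigh_product_bound_def
    proof (intro ballI)
      fix x y assume xy: "x \<in> ?I - {0}" "y \<in> ?I - {0}"
      then have "x \<in> K" "y \<in> K"
        using interior_subset by auto
      moreover from this have "x \<bullet> y > 0"
        using subdual_inner_interior_pos assms(2) xy by blast
      ultimately show "(A *v x) \<bullet> y \<le> (x \<bullet> y) * max (rayleigh_quotient A x) (rayleigh_quotient A y)"
        using c by (force simp: pos_divide_le_eq mult.commute)
    qed
    then show "rayleigh_product_bound A K"
      by (rule I_imp_K)
  qed
  show ?thesis
    unfolding a c[symmetric] rayleigh_product_bound_iff_sphere[OF K(1)] by simp
qed

end
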